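(* Let $c>0$, $s\in\mathbb{N}$, and let $G$ be an $n$-vertex graph with $\alpha(G)=cn$, where $n$ is sufficiently large. If for any two maximum independent sets $I_1,I_2$ of $G$ we have $e(G[I_1\triangle I_2])\le s\cdot|I_1\triangle I_2|$, then $h(G)\le \frac{5sn}{\log n}$.
   Context: $\log$ is base $2$. $\alpha(G)$ is the independence number; $I_1\triangle I_2$ is the symmetric difference; $e(G[X])$ is the number of edges of the subgraph induced on $X$. A hitting set of $G$ is a set $T\subseteq V(G)$ meeting every maximum independent set of $G$; $h(G)$ is the minimum size of a hitting set. *)

theory Defs
  imports Complex_Main "HOL-Library.Ramsey"
begin

text \<open>
  A finite simple graph is a finite vertex set \<open>V\<close> with a set \<open>E\<close> of two-element subsets
  of \<open>V\<close>. Independence is \<^const>\<open>indep\<close> from the library theory \<open>Ramsey\<close>.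
\<close>

definition simple_graph :: "'a set \<Rightarrow> 'a set set \<Rightarrow> bool" where
  "simple_graph V E \<longleftrightarrow> finite V \<and> E \<subseteq> nsets V 2"

definition independent_sets :: "'a set \<Rightarrow> 'a set set \<Rightarrow> 'a set set" where
  "independent_sets V E = {I. I \<subseteq> V \<and> indep I E}"

definition independence_number :: "'a set \<Rightarrow> 'a set set \<Rightarrow> nat" where
  "independence_number V E = Max (card ` independent_sets V E)"

definition max_independent_sets :: "'a set \<Rightarrow> 'a set set \<Rightarrow> 'a set set" where
  "max_independent_sets V E = {I \<in> independent_sets V E. card I = independence_number V E}"

definition induced_edges :: "'a set set \<Rightarrow> 'a set \<Rightarrow> 'a set set" where
  "induced_edges E X = {e \<in> E. e \<subseteq> X}"

definition hitting_sets :: "'a set \<Rightarrow> 'a set set \<Rightarrow> 'a set set" where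
  "hitting_sets V E = {T. T \<subseteq> V \<and> (\<forall>I \<in> max_independent_sets V E. T \<inter> I \<noteq> {})}"

text \<open>
  For nonempty \<open>V\<close> the set \<open>V\<close> itself is hitting, so the minimum below is over a nonempty
  finite set; for \<open>V = {}\<close> there is no hitting set and the value is unspecified.
\<close>

definition hitting_number :: "'a set \<Rightarrow> 'a set set \<Rightarrow> nat" where
  "hitting_number V E = Min (card ` hitting_sets V E)"

end

theory Submission
  imports Defs "HOL-Analysis.Function_Topology" "HOL-Real_Asymp.Real_Asymp"
begin

text \<open>
  Choose a probability distribution on the maximum independent sets that maximises
  \<open>\<Prod>v. p v\<close>, where \<open>p v\<close> is the probability that the random set contains \<open>v\<close> and \<open>v\<close>
  ranges over the covered vertices. By optimality every maximum independent set \<open>J\<close> satisfies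
  \<open>(\<Sum>v\<in>J. 1 / p v) \<le> n\<close>, so \<open>J\<close> contains at most \<open>n / 2^i\<close> vertices with
  \<open>p v < 1 / 2^i\<close>. Averaging the sparsity hypothesis over \<open>J\<close> shows that for any maximum
  independent set \<open>I\<close> the sum of \<open>p u\<close> over all edges \<open>vu\<close> with \<open>v \<in> I\<close> is at most
  \<open>2 s \<alpha>\<close>. Among about \<open>log n\<close> dyadic thresholds \<open>1 / 2^i\<close> there is therefore one for
  which the vertices of \<open>I\<close> have, on average, at most about \<open>4 s 2^i / log n\<close> neighbours \<open>u\<close>
  with \<open>p u \<ge> 1 / 2^i\<close>. Take \<open>A \<subseteq> I\<close> with slightly more than \<open>n / 2^i\<close> vertices and few such
  neighbours. Then \<open>A\<close> together with these neighbours is a hitting set: a maximum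
  independent set \<open>J\<close> avoiding it would have fewer than \<open>card A\<close> neighbours of \<open>A\<close>, and
  exchanging them for \<open>A\<close> would produce a larger independent set.
\<close>

section \<open>Probability weights on a finite family\<close>

text \<open>The simplex is a closed subset of a product of compact intervals, so Tychonoff applies.
  Pinning the coordinates outside \<open>F\<close> to 0 keeps the box compact although the vectors
  are functions on the whole type. Compactness provides the maximiser of the likelihood.\<close>

lemma compact_probability_vectors:
  assumes "finite F"
  shows "compact {m :: 'b \<Rightarrow> real. (\<forall>i. 0 \<le> m i) \<and> (\<forall>i. i \<notin> F \<longrightarrow> m i = 0) \<and> sum m F = 1}"
    (is "compact ?K")
proof -
  let ?B = "\<Pi>\<^sub>E i\<in>UNIV. (if i \<in> F then {0..1} else {0 :: real})"
  have "compactin (product_topology (\<lambda>_. euclidean) UNIV) ?B"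
    by (subst compactin_PiE) auto
  then have "compact ?B"
    by (simp add: euclidean_product_topology)
  moreover have "closed {m :: 'b \<Rightarrow> real. sum m F = 1}"
    by (intro closed_Collect_eq continuous_intros continuous_on_product_coordinates)
  ultimately have "compact (?B \<inter> {m. sum m F = 1})"
    by (rule compact_Int_closed)
  moreover have "?K = ?B \<inter> {m. sum m F = 1}"
  proof -
    have "m i \<le> 1" if "\<forall>i. 0 \<le> m i" "sum m F = 1" "i \<in> F" for m :: "'b \<Rightarrow> real" and i
      using member_le_sum[OF \<open>i \<in> F\<close>, of m] that assms by auto
    then show ?thesis
      by (auto simp: PiE_iff split: if_splits) (metis atLeastAtMost_iff singletonD order_refl)+
  qed
  ultimately show ?thesis
    by simp
qed

text \<open>
  The weights maximise the likelihood \<open>\<Prod>v. p v\<close>; the conclusion says that moving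
  mass towards a single \<open>J\<close> does not increase it to first order.
\<close>

lemma exists_balanced_weights:
  fixes F :: "'a set set"
  assumes "finite F" "F \<noteq> {}" "finite (\<Union>F)"
  obtains m :: "'a set \<Rightarrow> real" and p :: "'a \<Rightarrow> real"
  where "\<And>I. 0 \<le> m I" "sum m F = 1" "\<And>v. p v = (\<Sum>I\<in>F. m I * of_bool (v \<in> I))"
    "\<And>v. v \<in> \<Union>F \<Longrightarrow> p v > 0"
    "\<And>J. J \<in> F \<Longrightarrow> (\<Sum>v\<in>J. 1 / p v) \<le> card (\<Union>F)"
proof -
  define K where "K = {m :: 'a set \<Rightarrow> real. (\<forall>i. 0 \<le> m i) \<and> (\<forall>i. i \<notin> F \<longrightarrow> m i = 0) \<and> sum m F = 1}"
  define q where "q m v = (\<Sum>I\<in>F. m I * of_bool (v \<in> I))" for m :: "'a set \<Rightarrow> real" and v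
  define L where "L m = (\<Prod>v\<in>\<Union>F. q m v)" for m
  \<comment> \<open>The uniform distribution gives every covered vertex positive probability, so the
    maximum of \<open>L\<close> is positive and no factor vanishes at the maximiser.\<close>
  define u :: "'a set \<Rightarrow> real" where "u I = of_bool (I \<in> F) / card F" for I
  have cardF: "card F > 0"
    using assms by (simp add: card_gt_0_iff)
  have u: "u \<in> K"
    using cardF by (simp add: K_def u_def sum_divide_distrib[symmetric])
  have "compact K"
    unfolding K_def by (rule compact_probability_vectors[OF assms(1)])
  moreover have "continuous_on K L"
    unfolding L_def q_def
    by (intro continuous_intros continuous_on_subset[OF continuous_on_product_coordinates]) auto
  ultimately obtain m where m: "m \<in> K" and max: "\<And>y. y \<in> K \<Longrightarrow> L y \<le> L m"
    using continuous_attains_sup[of K L] u by blast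
  have m0: "0 \<le> m I" for I
    using m by (simp add: K_def)
  have q0: "0 \<le> q m v" for v
    unfolding q_def using m0 by (intro sum_nonneg) simp
  have "q u v > 0" if "v \<in> \<Union>F" for v
  proof -
    from that obtain I where I: "I \<in> F" "v \<in> I"
      by blast
    then have "0 < u I * of_bool (v \<in> I)"
      using cardF by (simp add: u_def)
    also have "\<dots> \<le> q u v"
      unfolding q_def using I assms(1) by (intro member_le_sum) (auto simp: u_def)
    finally show ?thesis .
  qed
  then have "L u > 0"
    unfolding L_def by (intro prod_pos) auto
  with max[OF u] have Lpos: "L m > 0"
    by linarith
  have qpos: "q m v > 0" if "v \<in> \<Union>F" for v
  proof -
    have "q m v \<noteq> 0"
      using Lpos that assms(3) unfolding L_def by (metis less_irrefl prod_zero_iff)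
    with q0[of v] show ?thesis
      by linarith
  qed
  have bound: "(\<Sum>v\<in>J. 1 / q m v) \<le> card (\<Union>F)" if J: "J \<in> F" for J
  proof (rule ccontr)
    assume neg: "\<not> ?thesis"
    \<comment> \<open>The segment from \<open>m\<close> to the point mass at \<open>J\<close>; along
      it each \<open>q (y t) v\<close> is affine in \<open>t\<close>.\<close>
    define y where "y t I = (1 - t) * m I + t * of_bool (I = J)" for t :: real and I
    have qy: "q (y t) v = (1 - t) * q m v + t * of_bool (v \<in> J)" for t v
    proof -
      have "q (y t) v = (1 - t) * q m v + t * (\<Sum>I\<in>F. of_bool (I = J) * of_bool (v \<in> I))"
        unfolding q_def y_def by (simp add: algebra_simps sum.distrib sum_distrib_left sum_subtractf)
      also have "(\<Sum>I\<in>F. of_bool (I = J) * of_bool (v \<in> I)) = (\<Sum>I\<in>F. if I = J then of_bool (v \<in> J) else (0::real))"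
        by (intro sum.cong) auto
      finally show ?thesis
        using J assms(1) by simp
    qed
    have yK: "y t \<in> K" if "0 \<le> t" "t \<le> 1" for t
    proof -
      have "sum (y t) F = (1 - t) * sum m F + t * (\<Sum>I\<in>F. of_bool (I = J))"
        unfolding y_def by (simp add: sum.distrib sum_distrib_left)
      also have "(\<Sum>I\<in>F. of_bool (I = J)) = (1::real)"
        using J assms(1) by (simp add: of_bool_def)
      finally show ?thesis
        using m that J unfolding K_def by (auto simp: y_def)
    qed
    \<comment> \<open>The logarithmic derivative of the likelihood at \<open>t = 0\<close>. It
      simplifies to \<open>(\<Sum>v\<in>J. 1 / q m v) - card (\<Union>F)\<close>, so a violated
      bound makes it positive and contradicts maximality.\<close>
    define D where "D = (\<Sum>v\<in>\<Union>F. (of_bool (v \<in> J) - q m v) / q m v)"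
    have y0: "q (y 0) v = q m v" for v
      by (simp add: qy)
    have "((\<lambda>t. q (y t) v) has_field_derivative (of_bool (v \<in> J) - q m v)) (at 0)" for v
      unfolding qy by (auto intro!: derivative_eq_intros)
    then have "((\<lambda>t. L (y t)) has_field_derivative L m * D) (at 0)"
      using has_field_derivative_prod'[of "\<Union>F" "\<lambda>v t. q (y t) v" 0 "\<lambda>v. of_bool (v \<in> J) - q m v"] qpos
      unfolding L_def D_def y0 by (metis (no_types, lifting) less_irrefl)
    moreover have "D > 0"
    proof -
      have "D = (\<Sum>v\<in>\<Union>F. of_bool (v \<in> J) * (1 / q m v) - 1)"
        unfolding D_def by (intro sum.cong refl) (use qpos in \<open>simp add: field_simps less_le\<close>)
      also have "\<dots> = (\<Sum>v\<in>\<Union>F. if v \<in> J then 1 / q m v else 0) - card (\<Union>F)"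
        by (subst sum_subtractf) (auto intro!: sum.cong)
      also have "(\<Sum>v\<in>\<Union>F. if v \<in> J then 1 / q m v else 0) = (\<Sum>v\<in>J. 1 / q m v)"
        using J assms(3) by (subst sum.inter_restrict[symmetric]) (auto intro!: sum.cong)
      finally show ?thesis
        using neg by simp
    qed
    ultimately obtain d where d: "d > 0" "\<And>h. 0 < h \<Longrightarrow> h < d \<Longrightarrow> L (y 0) < L (y (0 + h))"
      using has_real_derivative_pos_inc_right[of "\<lambda>t. L (y t)" "L m * D" 0 UNIV] Lpos by auto
    \<comment> \<open>The cap at 1 keeps \<open>y h\<close> inside the simplex.\<close>
    define h where "h = min (d/2) 1"
    have "L (y 0) < L (y h)"
      using d(2)[of h] d(1) by (simp add: h_def)
    moreover have "L (y h) \<le> L m"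
      using d(1) by (intro max yK) (auto simp: h_def)
    moreover have "L (y 0) = L m"
      by (simp add: L_def y0)
    ultimately show False
      by simp
  qed
  show ?thesis
    by (rule that[of m "q m"]) (use m m0 qpos bound in \<open>auto simp: K_def q_def\<close>)
qed

section \<open>Averaging and dyadic sums\<close>

text \<open>Starting from all of \<open>S\<close>, repeatedly delete an element with the largest
  value; this never raises the average. The inequality between averages is multiplied out to avoid
  dividing by zero.\<close>

lemma exists_subset_sum_le_average:
  fixes f :: "'a \<Rightarrow> real"
  assumes "finite S" "a \<le> card S"
  shows "\<exists>A\<subseteq>S. card A = a \<and> card S * sum f A \<le> a * sum f S"
  using assms(2)
proof (induction rule: inc_induct)
  case base
  show ?case by auto
next
  case (step a)
  then obtain A where A: "A \<subseteq> S" "card A = Suc a" "card S * sum f A \<le> Suc a * sum f S"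
    by blast
  have finA: "finite A" "A \<noteq> {}"
    using A by (auto intro: card_ge_0_finite)
  obtain x where x: "x \<in> A" "\<And>y. y \<in> A \<Longrightarrow> f y \<le> f x"
    using Max_in[of "f ` A"] Max_ge[of "f ` A"] finA by (metis finite_imageI imageE image_eqI image_is_empty)
  have "sum f A \<le> Suc a * f x"
    using sum_bounded_above[of A f "f x"] x A by simp
  then have "Suc a * sum f (A - {x}) \<le> a * sum f A"
    using x finA by (simp add: sum_diff1 algebra_simps)
  then have "card S * (Suc a * sum f (A - {x})) \<le> card S * (a * sum f A)"
    by (intro mult_left_mono) auto
  also have "\<dots> \<le> a * (Suc a * sum f S)"
    using A(3) by (metis mult.left_commute mult_left_mono of_nat_0_le_iff)
  finally have "real (Suc a) * (card S * sum f (A - {x})) \<le> real (Suc a) * (a * sum f S)"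
    by (simp add: mult_ac)
  then have "card S * sum f (A - {x}) \<le> a * sum f S"
    by (rule mult_left_le_imp_le) simp
  then show ?case
    using A x finA by (intro exI[of _ "A - {x}"]) auto
qed

text \<open>The surviving terms form part of a geometric series whose largest term is at most
  \<open>p\<close>, and such a series sums to at most twice its largest term.\<close>

lemma sum_dyadic_below_le:
  fixes p :: real
  assumes "finite S" "p \<ge> 0"
  shows "(\<Sum>i\<in>S. (1/2)^i * of_bool ((1/2)^i \<le> p) :: real) \<le> 2 * p"
proof -
  define R where "R = {i \<in> S. (1/2)^i \<le> p}"
  have "(\<Sum>i\<in>S. (1/2)^i * of_bool ((1/2)^i \<le> p)) = (\<Sum>i\<in>R. (1/2)^i :: real)"
    unfolding R_def sum.inter_filter[OF assms(1)] by (intro sum.cong) auto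
  also have "\<dots> \<le> 2 * p"
  proof (cases "R = {}")
    case False
    have "finite R"
      using assms by (simp add: R_def)
    define k where "k = Min R"
    have k: "k \<in> R" "\<And>i. i \<in> R \<Longrightarrow> k \<le> i"
      using False \<open>finite R\<close> by (auto simp: k_def)
    have "(\<Sum>i\<in>R. (1/2)^i) \<le> (\<Sum>i\<in>{k..Max R}. (1/2)^i :: real)"
      using \<open>finite R\<close> k by (intro sum_mono2) auto
    also have "\<dots> \<le> 2 * (1/2)^k"
      by (simp add: sum_gp)
    also have "\<dots> \<le> 2 * p"
      using k by (simp add: R_def)
    finally show ?thesis .
  qed (use assms in simp)
  finally show ?thesis .
qed

section \<open>Maximum independent sets, hitting sets and edge counts\<close>

lemma max_independent_setsD:
  assumes "simple_graph V E" "I \<in> max_independent_sets V E"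
  shows "I \<subseteq> V" "indep I E" "card I = independence_number V E" "finite I"
  using assms by (auto simp: simple_graph_def max_independent_sets_def independent_sets_def
      intro: finite_subset)

lemma finite_independent_sets:
  assumes "simple_graph V E"
  shows "finite (independent_sets V E)"
  using assms by (auto simp: simple_graph_def independent_sets_def)

lemma card_le_independence_number:
  assumes "simple_graph V E" "I \<subseteq> V" "indep I E"
  shows "card I \<le> independence_number V E"
  unfolding independence_number_def using assms
  by (intro Max_ge finite_imageI finite_independent_sets) (auto simp: independent_sets_def)

lemma max_independent_sets_nonempty:
  assumes "simple_graph V E"
  shows "max_independent_sets V E \<noteq> {}"
proof -
  have "{} \<in> independent_sets V E"
    by (simp add: independent_sets_def)
  then have "independence_number V E \<in> card ` independent_sets V E"
    unfolding independence_number_def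
    by (intro Max_in finite_imageI finite_independent_sets[OF assms]) auto
  then show ?thesis
    by (auto simp: max_independent_sets_def)
qed

lemma hitting_number_le_card:
  assumes "simple_graph V E" "T \<in> hitting_sets V E"
  shows "hitting_number V E \<le> card T"
  unfolding hitting_number_def using assms
  by (intro Min_le finite_imageI) (auto simp: hitting_sets_def simple_graph_def)

text \<open>An edge from \<open>I\<close> to \<open>J\<close> has no end in
  \<open>I \<inter> J\<close>, as it would then lie inside one of the two independent sets. Hence
  both ends are in the symmetric difference. No edge is counted twice: if both orientations
  occurred, both ends would be in \<open>I\<close>.\<close>

lemma edge_pairs_le_card_induced_edges:
  assumes "simple_graph V E" "finite I" "finite J" "indep I E" "indep J E"
  shows "(\<Sum>v\<in>I. \<Sum>u\<in>J. of_bool ({v, u} \<in> E)) \<le> card (induced_edges E (sym_diff I J))"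
proof -
  let ?P = "{(v, u) \<in> I \<times> J. {v, u} \<in> E}"
  have ne: "v \<noteq> u" if "{v, u} \<in> E" for v u
    using assms(1) that by (metis simple_graph_def doubleton_in_nsets_2 subsetD)
  have "(\<Sum>v\<in>I. \<Sum>u\<in>J. of_bool ({v, u} \<in> E)) = (\<Sum>x\<in>I \<times> J. of_bool (case x of (v, u) \<Rightarrow> {v, u} \<in> E) :: nat)"
    by (simp add: sum.cartesian_product split_def)
  also have "\<dots> = card ?P"
    using assms by (subst sum_of_bool_eq) (auto intro!: arg_cong[of _ _ card])
  also have "\<dots> \<le> card (induced_edges E (sym_diff I J))"
  proof (rule card_inj_on_le[of "\<lambda>(v, u). {v, u}"])
    show "inj_on (\<lambda>(v, u). {v, u}) ?P"
      using assms(4,5) ne by (fastforce simp: inj_on_def indep_def doubleton_eq_iff)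
    show "(\<lambda>(v, u). {v, u}) ` ?P \<subseteq> induced_edges E (sym_diff I J)"
      using assms(4,5) ne by (fastforce simp: induced_edges_def indep_def insert_commute)
    have "finite E"
      using assms(1) by (auto simp: simple_graph_def intro: finite_subset finite_imp_finite_nsets)
    then show "finite (induced_edges E (sym_diff I J))"
      by (simp add: induced_edges_def)
  qed
  finally show ?thesis .
qed

text \<open>Otherwise replacing \<open>J \<inter> N(A)\<close> by \<open>A\<close> would enlarge \<open>J\<close>.\<close>

lemma card_le_card_neighbours:
  assumes G: "simple_graph V E" and J: "J \<in> max_independent_sets V E"
    and A: "A \<subseteq> V" "indep A E" "A \<inter> J = {}"
  shows "card A \<le> card {u \<in> J. \<exists>v\<in>A. {v, u} \<in> E}"
proof -
  let ?B = "{u \<in> J. \<exists>v\<in>A. {v, u} \<in> E}"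
  note J' = max_independent_setsD[OF G J]
  have finA: "finite A"
    using A G by (auto simp: simple_graph_def intro: finite_subset)
  have "indep ((J - ?B) \<union> A) E"
    using A(2) J'(2) by (auto simp: indep_def) (metis insert_commute)+
  then have "card ((J - ?B) \<union> A) \<le> card J"
    unfolding J'(3) using A J'(1) by (intro card_le_independence_number[OF G]) auto
  moreover have "card ((J - ?B) \<union> A) = card (J - ?B) + card A"
    using A finA J'(4) by (intro card_Un_disjoint) auto
  moreover have "card (J - ?B) = card J - card ?B"
    using J'(4) by (intro card_Diff_subset) auto
  moreover have "card ?B \<le> card J"
    using J'(4) by (intro card_mono) auto
  ultimately show ?thesis
    by linarith
qed

section \<open>A hitting set from one of \<open>M\<close> dyadic thresholds\<close>

text \<open>The first factor of the bound is the size of \<open>A\<close>; the second allows for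
  each vertex of \<open>A\<close> itself and its average number of neighbours above the threshold.
  The assumption \<open>large\<close> ensures that a maximum independent set has room for
  \<open>A\<close>.\<close>

lemma hitting_number_dyadic_bound:
  fixes s L M :: nat
  assumes G: "simple_graph V E" and "M > 0"
    and large: "\<And>i. i \<in> {L..<L+M} \<Longrightarrow> card V div 2^i + 1 \<le> independence_number V E"
    and sparse: "\<And>I J. I \<in> max_independent_sets V E \<Longrightarrow> J \<in> max_independent_sets V E \<Longrightarrow>
      card (induced_edges E (sym_diff I J)) \<le> s * card (sym_diff I J)"
  obtains i where "i \<in> {L..<L+M}"
    "hitting_number V E \<le> real (card V div 2^i + 1) * (1 + 4 * s * 2^i / M)"
proof -
  define F where "F = max_independent_sets V E"
  define \<alpha> where "\<alpha> = independence_number V E"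
  note FD = max_independent_setsD[OF G, folded F_def \<alpha>_def]
  have finV: "finite V"
    using G by (simp add: simple_graph_def)
  have FV: "\<Union>F \<subseteq> V"
    using FD(1) by blast
  have finU: "finite (\<Union>F)"
    using FV finV by (rule finite_subset)
  have finF: "finite F"
    using finU by (rule finite_UnionD)
  have "F \<noteq> {}"
    unfolding F_def by (rule max_independent_sets_nonempty[OF G])
  then obtain I where I: "I \<in> F"
    by blast
  obtain m p where m0: "\<And>I. 0 \<le> m I" and m1: "sum m F = 1"
    and p: "\<And>v. p v = (\<Sum>I\<in>F. m I * of_bool (v \<in> I))"
    and ppos: "\<And>v. v \<in> \<Union>F \<Longrightarrow> p v > 0"
    and like: "\<And>J. J \<in> F \<Longrightarrow> (\<Sum>v\<in>J. 1 / p v) \<le> card (\<Union>F)"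
    using exists_balanced_weights[OF finF \<open>F \<noteq> {}\<close> finU] by metis
  have p0: "p v \<ge> 0" for v
    unfolding p using m0 by (intro sum_nonneg) simp
  define H where "H i = {u \<in> \<Union>F. (1/2)^i \<le> p u}" for i :: nat
  define d where "d i v = card {u \<in> H i. {v, u} \<in> E}" for i v
  have \<alpha>pos: "\<alpha> > 0"
    using large[of L] \<open>M > 0\<close> by (simp add: \<alpha>_def)

  \<comment> \<open>Expanding \<open>p u\<close> and exchanging sums turns the left side into the
    expected number of edges between \<open>I\<close> and a random \<open>J\<close>, which sparsity
    bounds for every single \<open>J\<close>.\<close>
  have "(\<Sum>v\<in>I. \<Sum>u\<in>\<Union>F. p u * of_bool ({v, u} \<in> E))
      = (\<Sum>v\<in>I. \<Sum>u\<in>\<Union>F. \<Sum>J\<in>F. m J * (of_bool (u \<in> J) * of_bool ({v, u} \<in> E)))"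
    unfolding p by (simp add: sum_distrib_right mult.assoc)
  also have "\<dots> = (\<Sum>v\<in>I. \<Sum>J\<in>F. \<Sum>u\<in>\<Union>F. m J * (of_bool (u \<in> J) * of_bool ({v, u} \<in> E)))"
    by (intro sum.cong refl sum.swap)
  also have "\<dots> = (\<Sum>J\<in>F. \<Sum>v\<in>I. \<Sum>u\<in>\<Union>F. m J * (of_bool (u \<in> J) * of_bool ({v, u} \<in> E)))"
    by (rule sum.swap)
  also have "\<dots> = (\<Sum>J\<in>F. m J * (\<Sum>v\<in>I. \<Sum>u\<in>\<Union>F. of_bool (u \<in> J) * of_bool ({v, u} \<in> E)))"
    by (simp add: sum_distrib_left)
  also have "\<dots> \<le> (\<Sum>J\<in>F. m J * (2 * s * \<alpha>))"
  proof (intro sum_mono mult_left_mono m0)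
    fix J assume J: "J \<in> F"
    have "(\<Sum>u\<in>\<Union>F. of_bool (u \<in> J) * of_bool ({v, u} \<in> E)) = (\<Sum>u\<in>J. of_bool ({v, u} \<in> E) :: real)" for v
      using finU J by (intro sum.mono_neutral_cong_right) auto
    then have "(\<Sum>v\<in>I. \<Sum>u\<in>\<Union>F. of_bool (u \<in> J) * of_bool ({v, u} \<in> E))
        = real (\<Sum>v\<in>I. \<Sum>u\<in>J. of_bool ({v, u} \<in> E))"
      by simp
    also have "\<dots> \<le> real (s * (\<alpha> + \<alpha>))"
    proof (intro of_nat_mono)
      have "(\<Sum>v\<in>I. \<Sum>u\<in>J. of_bool ({v, u} \<in> E)) \<le> card (induced_edges E (sym_diff I J))"
        using FD[OF I] FD[OF J] by (intro edge_pairs_le_card_induced_edges[OF G]) auto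
      also have "\<dots> \<le> s * card (sym_diff I J)"
        using sparse I J by (simp add: F_def)
      also have "\<dots> \<le> s * (\<alpha> + \<alpha>)"
      proof (intro mult_left_mono)
        have "card (sym_diff I J) \<le> card (I - J) + card (J - I)"
          by (rule card_Un_le)
        also have "\<dots> \<le> \<alpha> + \<alpha>"
          using FD[OF I] FD[OF J] by (intro add_mono) (metis card_mono Diff_subset)+
        finally show "card (sym_diff I J) \<le> \<alpha> + \<alpha>" .
      qed simp
      finally show "(\<Sum>v\<in>I. \<Sum>u\<in>J. of_bool ({v, u} \<in> E)) \<le> s * (\<alpha> + \<alpha>)" .
    qed
    finally show "(\<Sum>v\<in>I. \<Sum>u\<in>\<Union>F. of_bool (u \<in> J) * of_bool ({v, u} \<in> E)) \<le> real (2 * s * \<alpha>)"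
      by (simp add: algebra_simps)
  qed
  also have "\<dots> = 2 * s * \<alpha>"
    by (simp add: sum_distrib_right[symmetric] m1)
  finally have degree: "(\<Sum>v\<in>I. \<Sum>u\<in>\<Union>F. p u * of_bool ({v, u} \<in> E)) \<le> 2 * s * \<alpha>" .

  have d_eq: "real (d i v) = (\<Sum>u\<in>\<Union>F. of_bool ((1/2)^i \<le> p u) * of_bool ({v, u} \<in> E))" for i v
  proof -
    have "{u \<in> H i. {v, u} \<in> E} = \<Union>F \<inter> {u. (1/2)^i \<le> p u \<and> {v, u} \<in> E}"
      by (auto simp: H_def)
    then show ?thesis
      unfolding d_def using finU by (simp flip: of_bool_conj)
  qed
  \<comment> \<open>With weight \<open>(1/2)^i\<close> on threshold \<open>i\<close>, a neighbour
    \<open>u\<close> contributes at most \<open>2 * p u\<close> over all thresholds together, so the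
    total does not grow with \<open>M\<close>.\<close>
  have "(\<Sum>i\<in>{L..<L+M}. (1/2)^i * (\<Sum>v\<in>I. real (d i v)))
      = (\<Sum>i\<in>{L..<L+M}. \<Sum>v\<in>I. \<Sum>u\<in>\<Union>F. (1/2)^i * of_bool ((1/2)^i \<le> p u) * of_bool ({v, u} \<in> E))"
    unfolding d_eq by (simp add: sum_distrib_left mult.assoc)
  also have "\<dots> = (\<Sum>v\<in>I. \<Sum>i\<in>{L..<L+M}. \<Sum>u\<in>\<Union>F. (1/2)^i * of_bool ((1/2)^i \<le> p u) * of_bool ({v, u} \<in> E))"
    by (rule sum.swap)
  also have "\<dots> = (\<Sum>v\<in>I. \<Sum>u\<in>\<Union>F. \<Sum>i\<in>{L..<L+M}. (1/2)^i * of_bool ((1/2)^i \<le> p u) * of_bool ({v, u} \<in> E))"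
    by (intro sum.cong refl sum.swap)
  also have "\<dots> = (\<Sum>v\<in>I. \<Sum>u\<in>\<Union>F. (\<Sum>i\<in>{L..<L+M}. (1/2)^i * of_bool ((1/2)^i \<le> p u)) * of_bool ({v, u} \<in> E))"
    by (simp only: sum_distrib_right)
  also have "\<dots> \<le> (\<Sum>v\<in>I. \<Sum>u\<in>\<Union>F. (2 * p u) * of_bool ({v, u} \<in> E))"
    by (intro sum_mono mult_right_mono sum_dyadic_below_le p0) auto
  also have "\<dots> = 2 * (\<Sum>v\<in>I. \<Sum>u\<in>\<Union>F. p u * of_bool ({v, u} \<in> E))"
    by (simp add: sum_distrib_left mult.assoc)
  also have "\<dots> \<le> 4 * s * \<alpha>"
    using degree by (simp add: mult.commute mult.left_commute)
  finally have total: "(\<Sum>i\<in>{L..<L+M}. (1/2)^i * (\<Sum>v\<in>I. real (d i v))) \<le> 4 * s * \<alpha>" .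

  \<comment> \<open>Pigeonhole: one of the \<open>M\<close> thresholds is at most the
    average.\<close>
  obtain i where i: "i \<in> {L..<L+M}" "(1/2)^i * (\<Sum>v\<in>I. real (d i v)) \<le> 4 * s * \<alpha> / M"
  proof (rule ccontr)
    assume "\<not> thesis"
    with that have "\<And>i. i \<in> {L..<L+M} \<Longrightarrow> 4 * s * \<alpha> / M < (1/2)^i * (\<Sum>v\<in>I. real (d i v))"
      by (meson not_le)
    then have "(\<Sum>i\<in>{L..<L+M}. 4 * s * \<alpha> / M) < (\<Sum>i\<in>{L..<L+M}. (1/2)^i * (\<Sum>v\<in>I. real (d i v)))"
      using \<open>M > 0\<close> by (intro sum_strict_mono) auto
    then show False
      using total \<open>M > 0\<close> by simp
  qed
  \<comment> \<open>The least integer strictly above \<open>card V / 2^i\<close>; strictness yields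
    the final contradiction.\<close>
  define a where "a = card V div 2^i + 1"
  have "a \<le> card I"
    using large[OF i(1)] FD(3)[OF I] by (simp add: a_def \<alpha>_def)
  then obtain A where A: "A \<subseteq> I" "card A = a" "card I * (\<Sum>v\<in>A. real (d i v)) \<le> a * (\<Sum>v\<in>I. real (d i v))"
    using exists_subset_sum_le_average[of I a "\<lambda>v. real (d i v)"] FD(4)[OF I] by blast
  have AV: "A \<subseteq> V" and indepA: "indep A E" and finA: "finite A"
    using A(1) FD[OF I] by (auto intro: finite_subset smaller_indep)
  have "\<alpha> * (\<Sum>v\<in>A. real (d i v)) \<le> a * (\<Sum>v\<in>I. real (d i v))"
    using A(3) FD(3)[OF I] by simp
  also have "\<dots> \<le> a * (4 * s * \<alpha> / M * 2^i)"
    using i(2) by (intro mult_left_mono) (simp_all add: power_divide field_simps)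
  also have "\<dots> = \<alpha> * (a * (4 * s * 2^i / M))"
    by simp
  finally have dA: "(\<Sum>v\<in>A. real (d i v)) \<le> a * (4 * s * 2^i / M)"
    by (rule mult_left_le_imp_le) (use \<alpha>pos in simp)

  define T where "T = A \<union> (\<Union>v\<in>A. {u \<in> H i. {v, u} \<in> E})"
  have "card T \<le> a + card (\<Union>v\<in>A. {u \<in> H i. {v, u} \<in> E})"
    unfolding T_def A(2)[symmetric] by (rule card_Un_le)
  also have "card (\<Union>v\<in>A. {u \<in> H i. {v, u} \<in> E}) \<le> (\<Sum>v\<in>A. d i v)"
    unfolding d_def by (rule card_UN_le[OF finA])
  finally have "real (card T) \<le> a + (\<Sum>v\<in>A. real (d i v))"
    by (simp flip: of_nat_sum of_nat_add)
  with dA have cardT: "real (card T) \<le> a * (1 + 4 * s * 2^i / M)"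
    by (simp add: algebra_simps)

  have "T \<inter> J \<noteq> {}" if J: "J \<in> F" for J
  proof
    assume TJ: "T \<inter> J = {}"
    define B where "B = {u \<in> J. \<exists>v\<in>A. {v, u} \<in> E}"
    have finB: "finite B"
      using FD(4)[OF J] by (simp add: B_def)
    have "a \<le> card B"
      unfolding B_def A(2)[symmetric] using TJ J
      by (intro card_le_card_neighbours[OF G] AV indepA) (auto simp: T_def F_def)
    \<comment> \<open>A neighbour of \<open>A\<close> at or above the threshold belongs to
      \<open>T\<close>, which \<open>J\<close> avoids. So each \<open>u\<close> in \<open>B\<close>
      contributes at least \<open>2^i\<close> to the sum of \<open>1 / p u\<close> over
      \<open>J\<close>, and that sum is at most \<open>card V\<close>.\<close>
    have low: "p u < (1/2)^i" if "u \<in> B" for u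
    proof (rule ccontr)
      assume "\<not> p u < (1/2)^i"
      then have "u \<in> H i"
        using that J by (auto simp: B_def H_def)
      then show False
        using that TJ unfolding B_def T_def by blast
    qed
    have "card B * 2^i = (\<Sum>u\<in>B. 2^i :: real)"
      by simp
    also have "\<dots> \<le> (\<Sum>u\<in>B. 1 / p u)"
    proof (intro sum_mono)
      fix u assume "u \<in> B"
      then have "p u > 0" "p u < (1/2)^i"
        using ppos J low by (auto simp: B_def)
      then show "2^i \<le> 1 / p u"
        by (simp add: power_divide field_simps)
    qed
    also have "\<dots> \<le> (\<Sum>u\<in>J. 1 / p u)"
      using FD(4)[OF J] p0 by (intro sum_mono2) (auto simp: B_def)
    also have "\<dots> \<le> card (\<Union>F)"
      by (rule like[OF J])
    also have "\<dots> \<le> card V"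
      using FV finV by (simp add: card_mono)
    finally have "card B * 2^i \<le> card V"
      by (metis of_nat_le_iff of_nat_mult of_nat_numeral of_nat_power)
    then have "card B \<le> card V div 2^i"
      by (simp add: less_eq_div_iff_mult_less_eq)
    with \<open>a \<le> card B\<close> show False
      by (simp add: a_def)
  qed
  then have "T \<in> hitting_sets V E"
    using AV FV by (auto simp: hitting_sets_def F_def T_def H_def)
  then have "real (hitting_number V E) \<le> card T"
    using hitting_number_le_card[OF G] by simp
  with cardT show ?thesis
    using that[OF i(1)] by (simp add: a_def)
qed

section \<open>Choice of the dyadic range and asymptotics\<close>

theorem theorem3p1:
  fixes c :: real and s :: nat
  assumes "c > 0" and "s \<ge> 1"
  shows "\<exists>N. \<forall>n\<ge>N. \<forall>(V :: 'a set) E.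
    simple_graph V E \<longrightarrow> card V = n \<longrightarrow> real (independence_number V E) = c * real n \<longrightarrow>
    (\<forall>I1 \<in> max_independent_sets V E. \<forall>I2 \<in> max_independent_sets V E.
       card (induced_edges E (sym_diff I1 I2)) \<le> s * card (sym_diff I1 I2)) \<longrightarrow>
    real (hitting_number V E) \<le> 5 * real s * real n / log 2 (real n)"
proof -
  \<comment> \<open>Makes the independence number at least the size of \<open>A\<close> for every
    threshold in the range.\<close>
  have "eventually (\<lambda>n. n powr 0.95 + 1 \<le> c * n) (at_top :: real filter)"
    using assms(1) by real_asymp
  moreover have "eventually (\<lambda>n. n powr 0.95 + 1 + (n + 4 * n powr 0.9) * 4 / (0.85 * log 2 n)
      \<le> 5 * n / log 2 n) (at_top :: real filter)"
  proof -
    \<comment> \<open>The goal multiplied by \<open>log 2 n\<close>. Here \<open>80 / 17\<close> is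
      \<open>4 / 0.85\<close>, which is below 5 and so leaves room for the lower-order
      terms.\<close>
    have "eventually (\<lambda>n. (n powr 0.95 + 1) * log 2 n + (n + 4 * n powr 0.9) * (80 / 17) \<le> 5 * n)
        (at_top :: real filter)"
      by real_asymp
    moreover have "eventually (\<lambda>n. n > 1) (at_top :: real filter)"
      by (rule eventually_gt_at_top)
    ultimately show ?thesis
    proof eventually_elim
      case (elim n)
      then have "log 2 n > 0"
        by simp
      have "n powr 0.95 + 1 + (n + 4 * n powr 0.9) * 4 / (0.85 * log 2 n)
          = ((n powr 0.95 + 1) * log 2 n + (n + 4 * n powr 0.9) * (80 / 17)) / log 2 n"
        using \<open>log 2 n > 0\<close> by (simp add: add_divide_distrib)
      also have "\<dots> \<le> 5 * n / log 2 n"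
        using elim(1) \<open>log 2 n > 0\<close> by (intro divide_right_mono) auto
      finally show ?case .
    qed
  qed
  moreover have "eventually (\<lambda>n. n \<ge> 2) (at_top :: real filter)"
    by (rule eventually_ge_at_top)
  ultimately have "eventually (\<lambda>n. n powr 0.95 + 1 \<le> c * n \<and>
      n powr 0.95 + 1 + (n + 4 * n powr 0.9) * 4 / (0.85 * log 2 n) \<le> 5 * n / log 2 n \<and> n \<ge> 2)
      (at_top :: real filter)"
    by eventually_elim blast
  then have "eventually (\<lambda>n. real n powr 0.95 + 1 \<le> c * n \<and>
      real n powr 0.95 + 1 + (n + 4 * real n powr 0.9) * 4 / (0.85 * log 2 n) \<le> 5 * real n / log 2 n \<and>
      real n \<ge> 2) sequentially"
    using filterlim_real_sequentially by (rule eventually_compose_filterlim)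
  then obtain N where N: "\<And>n. n \<ge> N \<Longrightarrow> real n powr 0.95 + 1 \<le> c * n \<and>
      real n powr 0.95 + 1 + (n + 4 * real n powr 0.9) * 4 / (0.85 * log 2 n) \<le> 5 * real n / log 2 n \<and>
      real n \<ge> 2"
    unfolding eventually_sequentially by blast
  show ?thesis
  proof (intro exI[of _ N] allI impI)
    fix n and V :: "'a set" and E
    assume "n \<ge> N" and G: "simple_graph V E" and cV: "card V = n"
      and \<alpha>: "real (independence_number V E) = c * real n"
      and sparse: "\<forall>I1 \<in> max_independent_sets V E. \<forall>I2 \<in> max_independent_sets V E.
        card (induced_edges E (sym_diff I1 I2)) \<le> s * card (sym_diff I1 I2)"
    note n = N[OF \<open>n \<ge> N\<close>, THEN conjunct1] N[OF \<open>n \<ge> N\<close>, THEN conjunct2, THEN conjunct1]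
    have n2: "real n \<ge> 2"
      using N[OF \<open>n \<ge> N\<close>] by blast
    define l where "l = log 2 (real n)"
    have l1: "l \<ge> 1"
      using n2 by (simp add: l_def le_log_iff)
    have npowr: "real n powr x = 2 powr (x * l)" for x
      using n2 by (simp add: l_def powr_def log_def)
    \<comment> \<open>The thresholds run from about \<open>n powr 0.05\<close> to about
      \<open>n powr 0.9\<close>: then \<open>n / 2^i\<close> is of lower order than
      \<open>n / log n\<close>, and \<open>2^i\<close> is of lower order than \<open>n\<close>. Any
      range of more than \<open>0.8 * l\<close> thresholds would give a leading constant below
      5.\<close>
    define L where "L = nat \<lceil>l / 20\<rceil>"
    define M where "M = nat \<lceil>0.85 * l\<rceil>"
    have L: "l / 20 \<le> L" "L \<le> l / 20 + 1"
      using l1 unfolding L_def by linarith+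
    have M: "0.85 * l \<le> M" "M \<le> 0.85 * l + 1" "M > 0"
    proof -
      show "0.85 * l \<le> M"
        unfolding M_def by linarith
      show "M \<le> 0.85 * l + 1"
        using l1 ceiling_correct[of "0.85 * l"] unfolding M_def by (subst of_nat_nat) auto
      show "M > 0"
        using l1 by (simp add: M_def)
    qed
    have scale: "real (n div 2^i + 1) \<le> n / 2^i + 1" "n / 2^i \<le> real n powr 0.95"
      "2^i \<le> 4 * real n powr 0.9" if i: "i \<in> {L..<L+M}" for i
    proof -
      have lo: "l / 20 \<le> i"
        using i L by auto
      have "real i \<le> real (L + M)"
        using i by (intro of_nat_mono) auto
      \<comment> \<open>Each of the two ceilings costs at most 1; this is the source of the factor 4
        in \<open>4 * real n powr 0.9\<close>.\<close>
      then have hi: "i \<le> 0.9 * l + 2"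
        using L M by auto
      show "real (n div 2^i + 1) \<le> n / 2^i + 1"
        using of_nat_div_le_of_nat[of n "2^i"] by simp
      have "n / 2^i = 2 powr (l - i)"
        using npowr[of 1] n2 by (simp add: powr_diff powr_realpow)
      also have "\<dots> \<le> real n powr 0.95"
        unfolding npowr using lo by (intro powr_mono) auto
      finally show "n / 2^i \<le> real n powr 0.95" .
      have "2^i = 2 powr real i"
        by (simp add: powr_realpow)
      also have "\<dots> \<le> 2 powr (0.9 * l + 2)"
        using hi by (intro powr_mono) auto
      also have "\<dots> = 4 * real n powr 0.9"
        unfolding npowr by (simp add: powr_add)
      finally show "2^i \<le> 4 * real n powr 0.9" .
    qed
    obtain i where i: "i \<in> {L..<L+M}"
      and h: "hitting_number V E \<le> real (n div 2^i + 1) * (1 + 4 * s * 2^i / M)"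
    proof (rule hitting_number_dyadic_bound[OF G \<open>M > 0\<close>, of L s, unfolded cV])
      fix i assume "i \<in> {L..<L+M}"
      then have "real (n div 2^i + 1) \<le> real (independence_number V E)"
        using scale[of i] n(1) \<alpha> by linarith
      then show "n div 2^i + 1 \<le> independence_number V E"
        by simp
    qed (use sparse in auto)
    note sc = scale[OF i]
    have "real (hitting_number V E) \<le> (n / 2^i + 1) * (1 + 4 * s * 2^i / M)"
      using h sc(1) by (smt (verit) mult_right_mono divide_nonneg_nonneg of_nat_0_le_iff zero_le_power mult_nonneg_nonneg)
    also have "\<dots> = n / 2^i + 1 + s * ((n + 2^i) * 4 / M)"
      using M(3) by (simp add: field_simps)
    also have "\<dots> \<le> (real n powr 0.95 + 1) + s * ((n + 4 * real n powr 0.9) * 4 / (0.85 * l))"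
      using sc M l1 by (intro add_mono mult_left_mono frac_le mult_right_mono) auto
    \<comment> \<open>Since \<open>s \<ge> 1\<close>, the term without \<open>s\<close> can be
      absorbed, leaving an inequality in \<open>n\<close> alone; hence \<open>N\<close> does not
      depend on \<open>s\<close>.\<close>
    also have "\<dots> \<le> s * (real n powr 0.95 + 1) + s * ((n + 4 * real n powr 0.9) * 4 / (0.85 * l))"
      using mult_right_mono[of 1 "real s" "real n powr 0.95 + 1"] assms(2) by simp
    also have "\<dots> = s * (real n powr 0.95 + 1 + (n + 4 * real n powr 0.9) * 4 / (0.85 * l))"
      by (simp only: distrib_left)
    also have "\<dots> \<le> s * (5 * real n / l)"
      using n(2) by (intro mult_left_mono) (auto simp: l_def)
    finally show "real (hitting_number V E) \<le> 5 * real s * real n / log 2 (real n)"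
      by (simp add: l_def mult_ac)
  qed
qed

end
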